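(* Let $\sigma>0$, $k>0$, $P=\mathcal N(0,\sigma^2)$. The optimal value $J^\star$ of the Witsenhausen problem satisfies $$J^\star=1-\sup_{Q\in\mathcal P_2(\mathbb R)}\bigl\{\mathcal I(Q*\phi)-k^2W_2^2(P,Q)\bigr\}.$$
   Context: Witsenhausen problem: $X_0\sim P$ and $N\sim\mathcal N(0,1)$ are independent; $J^\star$ is the infimum over measurable $\gamma_1,\gamma_2:\mathbb R\to\mathbb R$ of $k^2\mathbb E[U_1^2]+\mathbb E[(Y-U_2)^2]$, where $U_1=\gamma_1(X_0)$, $Y=X_0+U_1$, $U_2=\gamma_2(Y+N)$. $\mathcal P_2(\mathbb R)$ is the set of Borel probability measures with finite second moment; $\phi$ is the standard normal density and $(Q*\phi)(z)=\int\phi(z-y)\,Q(dy)$. Fisher information: $\mathcal I(\rho)=\int\rho'(z)^2/\rho(z)\,dz$. $W_2^2(P,Q)=\inf_\pi\int(x-y)^2\,\pi(dx,dy)$ over couplings $\pi$ of $P,Q$. *)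

theory Defs
  imports "HOL-Probability.Probability"
begin

text \<open>
  Costs, Fisher informations and transport costs are nonnegative integrals and are
  taken in \<^typ>\<open>ennreal\<close>, so that an infinite cost counts as \<open>\<infinity>\<close> rather than as the
  default value \<open>0\<close> of a Bochner integral.
\<close>

definition witsenhausen_cost ::
  "real \<Rightarrow> 'a measure \<Rightarrow> ('a \<Rightarrow> real) \<Rightarrow> ('a \<Rightarrow> real) \<Rightarrow> (real \<Rightarrow> real) \<Rightarrow> (real \<Rightarrow> real) \<Rightarrow> ennreal"
where
  "witsenhausen_cost k M X0 N \<gamma>1 \<gamma>2 =
    (let U1 = (\<lambda>\<omega>. \<gamma>1 (X0 \<omega>));
         Y = (\<lambda>\<omega>. X0 \<omega> + U1 \<omega>);
         U2 = (\<lambda>\<omega>. \<gamma>2 (Y \<omega> + N \<omega>))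
     in ennreal (k\<^sup>2) * (\<integral>\<^sup>+\<omega>. ennreal ((U1 \<omega>)\<^sup>2) \<partial>M) + (\<integral>\<^sup>+\<omega>. ennreal ((Y \<omega> - U2 \<omega>)\<^sup>2) \<partial>M))"

definition witsenhausen_value ::
  "real \<Rightarrow> 'a measure \<Rightarrow> ('a \<Rightarrow> real) \<Rightarrow> ('a \<Rightarrow> real) \<Rightarrow> ennreal"
where
  "witsenhausen_value k M X0 N =
    (INF (\<gamma>1, \<gamma>2) \<in> borel_measurable borel \<times> borel_measurable borel. witsenhausen_cost k M X0 N \<gamma>1 \<gamma>2)"

definition P2 :: "real measure set" where
  "P2 = {Q. prob_space Q \<and> sets Q = sets borel \<and> (\<integral>\<^sup>+x. ennreal (x\<^sup>2) \<partial>Q) < \<infinity>}"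

definition gauss_smooth :: "real measure \<Rightarrow> real \<Rightarrow> real" where
  "gauss_smooth Q z = (\<integral>y. std_normal_density (z - y) \<partial>Q)"

definition fisher_information :: "(real \<Rightarrow> real) \<Rightarrow> ennreal" where
  "fisher_information \<rho> = (\<integral>\<^sup>+z. ennreal ((deriv \<rho> z)\<^sup>2 / \<rho> z) \<partial>lborel)"

definition couplings :: "real measure \<Rightarrow> real measure \<Rightarrow> (real \<times> real) measure set" where
  "couplings P Q =
    {\<pi>. prob_space \<pi> \<and> sets \<pi> = sets (borel \<Otimes>\<^sub>M borel) \<and> distr \<pi> borel fst = P \<and> distr \<pi> borel snd = Q}"

definition W2_squared :: "real measure \<Rightarrow> real measure \<Rightarrow> ennreal" where
  "W2_squared P Q = (INF \<pi> \<in> couplings P Q. \<integral>\<^sup>+(x, y). ennreal ((x - y)\<^sup>2) \<partial>\<pi>)"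

end

theory Submission imports Defs begin

text \<open>
  For \<open>Y \<sim> Q\<close> and \<open>Z = Y + N\<close> with density \<open>\<rho> = Q * \<phi>\<close>, completing the square in the
  estimate \<open>\<gamma>(z)\<close> gives \<open>E (Y - \<gamma>(Z))\<^sup>2 + I(\<rho>) = 1 + \<integral> \<rho> (\<gamma> - z - \<rho>'/\<rho>)\<^sup>2\<close>, so the least
  mean square error is \<open>1 - I(\<rho>)\<close>. A controller \<open>\<gamma>1\<close> induces the coupling of \<open>X0\<close> and \<open>Y\<close>,
  whence \<open>J \<ge> 1 - sup\<close>. Conversely, for a coupling \<open>\<pi>\<close> of \<open>P\<close> and \<open>Q\<close> and a fixed bounded,
  nearly optimal \<open>\<gamma>\<close>, the cost is the integral over \<open>\<pi>\<close> of a function \<open>c(x, y)\<close> continuous in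
  \<open>y\<close>; replacing \<open>y\<close> by a measurably chosen near-minimizer of \<open>c(x, \<cdot>)\<close> gives a deterministic
  controller that is no worse up to \<open>\<epsilon>\<close>.
\<close>

section \<open>Uniform bounds for the standard normal density\<close>

text \<open>From \<open>1 + t <= exp t\<close> at \<open>t = u^2 / 2\<close>: any nonnegative factor
  at most \<open>2 * (1 + u^2 / 2)\<close> is absorbed by the exponential, leaving the constant 2.
  The factors 1, \<open>|u|\<close> and \<open>u^2\<close> all qualify. Boundedness makes the
  kernels integrable against every probability measure.\<close>

lemma std_normal_density_moment_bounds:
  "std_normal_density u \<le> 2" "\<bar>u * std_normal_density u\<bar> \<le> 2" "u\<^sup>2 * std_normal_density u \<le> 2"
proof -
  have s: "1 / sqrt (2 * pi) \<le> 1" "0 \<le> 1 / sqrt (2 * pi)"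
    using pi_ge_two by (auto simp: field_simps real_le_rsqrt)
  have e: "(1 + u\<^sup>2 / 2) * exp (- u\<^sup>2 / 2) \<le> 1"
    using exp_ge_add_one_self[of "u\<^sup>2 / 2"] by (simp add: exp_minus field_simps)
  have e0: "exp (- u\<^sup>2 / 2) > 0" by simp
  have d: "std_normal_density u \<le> exp (- u\<^sup>2 / 2)"
    using mult_right_mono[OF s(1), of "exp (- u\<^sup>2 / 2)"] by (simp add: std_normal_density_def)
  have g: "c * std_normal_density u \<le> 2" if "0 \<le> c" "c \<le> 2 * (1 + u\<^sup>2 / 2)" for c
  proof -
    have "c * std_normal_density u \<le> (2 * (1 + u\<^sup>2 / 2)) * exp (- u\<^sup>2 / 2)"
      using that d by (intro mult_mono) auto
    then show ?thesis using e by (simp add: field_simps)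
  qed
  have "\<bar>u\<bar> \<le> 2 * (1 + u\<^sup>2 / 2)"
    using zero_le_power2[of "\<bar>u\<bar> - 1"] by (simp add: power2_eq_square algebra_simps abs_mult_self_eq)
  then show "\<bar>u * std_normal_density u\<bar> \<le> 2" using g[of "\<bar>u\<bar>"] by (simp add: abs_mult)
  show "std_normal_density u \<le> 2" using g[of 1] by simp
  show "u\<^sup>2 * std_normal_density u \<le> 2" using g[of "u\<^sup>2"] by simp
qed

lemma has_field_derivative_std_normal_density:
  "(std_normal_density has_field_derivative - u * std_normal_density u) (at u within A)"
  unfolding std_normal_density_def
  by (rule derivative_eq_intros refl | simp)+

text \<open>Mean value inequality with the preceding derivative bound. It supplies the constant
  dominating the difference quotients when differentiating under the integral.\<close>

lemma std_normal_density_lipschitz: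
  "\<bar>std_normal_density a - std_normal_density b\<bar> \<le> 2 * \<bar>a - b\<bar>"
  using field_differentiable_bound[of UNIV std_normal_density "\<lambda>u. - u * std_normal_density u" 2 a b]
    has_field_derivative_std_normal_density std_normal_density_moment_bounds(2)
  by auto

section \<open>Density of the observation and its derivative\<close>

context
  fixes Q :: "real measure"
  assumes Q: "prob_space Q" and sets_Q[measurable_cong]: "sets Q = sets borel"
begin

interpretation prob_space Q by (fact Q)

lemma integrable_std_normal_density_shift:
  "integrable Q (\<lambda>y. std_normal_density (z - y))"
  "integrable Q (\<lambda>y. (z - y) * std_normal_density (z - y))"
  "integrable Q (\<lambda>y. (z - y)\<^sup>2 * std_normal_density (z - y))"
  using std_normal_density_moment_bounds
  by (auto intro!: integrable_const_bound[of _ 2])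

text \<open>Differentiation under the integral by dominated convergence along an arbitrary null
  sequence of nonzero increments. The dominating function is the constant 2, integrable since
  \<open>Q\<close> has mass 1.\<close>

lemma gauss_smooth_has_field_derivative:
  "(gauss_smooth Q has_field_derivative
     - (\<integral>y. (z - y) * std_normal_density (z - y) \<partial>Q)) (at z)"
  unfolding DERIV_def tendsto_at_iff_sequentially comp_def
proof safe
  fix h :: "nat \<Rightarrow> real"
  assume h: "\<forall>i. h i \<in> UNIV - {0}" "h \<longlonglongrightarrow> 0"
  let ?d = "\<lambda>i y. (std_normal_density (z + h i - y) - std_normal_density (z - y)) / h i"
  have "(\<lambda>i. \<integral>y. ?d i y \<partial>Q) \<longlonglongrightarrow> (\<integral>y. - (z - y) * std_normal_density (z - y) \<partial>Q)"
  proof (rule integral_dominated_convergence[where w = "\<lambda>_. 2"])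
    show "AE y in Q. (\<lambda>i. ?d i y) \<longlonglongrightarrow> - (z - y) * std_normal_density (z - y)"
    proof (rule AE_I2)
      fix y
      have "((\<lambda>t. (std_normal_density ((z - y) + t) - std_normal_density (z - y)) / t)
              \<longlongrightarrow> - (z - y) * std_normal_density (z - y)) (at 0)"
        using has_field_derivative_std_normal_density[of "z - y" UNIV]
        by (simp add: DERIV_def)
      then show "(\<lambda>i. ?d i y) \<longlonglongrightarrow> - (z - y) * std_normal_density (z - y)"
        using h unfolding tendsto_at_iff_sequentially comp_def
        by (simp add: algebra_simps)
    qed
    show "AE y in Q. norm (?d i y) \<le> 2" for i
    proof (rule AE_I2)
      fix y
      show "norm (?d i y) \<le> 2"
        using h std_normal_density_lipschitz[of "z + h i - y" "z - y"] by (simp add: field_simps)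
    qed
  qed auto
  moreover have "(\<integral>y. ?d i y \<partial>Q) = (gauss_smooth Q (z + h i) - gauss_smooth Q z) / h i" for i
    unfolding gauss_smooth_def integral_divide_zero
    by (subst Bochner_Integration.integral_diff) (auto intro: integrable_std_normal_density_shift(1))
  ultimately show "(\<lambda>i. (gauss_smooth Q (z + h i) - gauss_smooth Q z) / h i)
      \<longlonglongrightarrow> - (\<integral>y. (z - y) * std_normal_density (z - y) \<partial>Q)"
    by (simp only: mult_minus_left Bochner_Integration.integral_minus)
qed

lemma deriv_gauss_smooth:
  "deriv (gauss_smooth Q) z = - (\<integral>y. (z - y) * std_normal_density (z - y) \<partial>Q)"
  by (rule DERIV_imp_deriv[OF gauss_smooth_has_field_derivative])

text \<open>A nonnegative integrand with integral 0 vanishes almost everywhere, which a positive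
  density cannot do under a probability measure. Thus the quotients by the smoothed density never
  fall under the convention that division by 0 yields 0.\<close>

lemma gauss_smooth_pos: "0 < gauss_smooth Q z"
proof -
  have "gauss_smooth Q z \<noteq> 0"
    using integral_nonneg_eq_0_iff_AE[OF integrable_std_normal_density_shift(1), of z]
      normal_density_pos[of 1 0] AE_False
    by (simp add: gauss_smooth_def less_imp_neq[symmetric])
  moreover have "0 \<le> gauss_smooth Q z" by (simp add: gauss_smooth_def)
  ultimately show ?thesis by simp
qed

lemma borel_measurable_gauss_smooth [measurable]:
  "gauss_smooth Q \<in> borel_measurable borel" "deriv (gauss_smooth Q) \<in> borel_measurable borel"
proof -
  show "gauss_smooth Q \<in> borel_measurable borel"
    unfolding gauss_smooth_def[abs_def] by measurable
  show "deriv (gauss_smooth Q) \<in> borel_measurable borel"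
    unfolding deriv_gauss_smooth[abs_def] by measurable
qed

text \<open>Completing the square in \<open>g\<close> at a fixed observation \<open>z\<close>; the
  minimizer is the posterior mean. The Fisher term is added on the left because subtraction in
  \<open>ennreal\<close> truncates.\<close>

lemma posterior_risk_decomposition:
  fixes g z :: real
  defines "\<rho> \<equiv> gauss_smooth Q z" and "\<rho>' \<equiv> deriv (gauss_smooth Q) z"
  shows "(\<integral>\<^sup>+y. ennreal ((y - g)\<^sup>2 * std_normal_density (z - y)) \<partial>Q) + ennreal (\<rho>'\<^sup>2 / \<rho>) =
    (\<integral>\<^sup>+y. ennreal ((z - y)\<^sup>2 * std_normal_density (z - y)) \<partial>Q) + ennreal (\<rho> * (g - (z + \<rho>' / \<rho>))\<^sup>2)"
proof -
  let ?f = "\<lambda>y. std_normal_density (z - y)" and ?a = "g - z"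
  note int = integrable_std_normal_density_shift[of z]
  \<comment> \<open>Since \<open>y - g = - ((z - y) + ?a)\<close>, only three integrals occur; the
    middle one is \<open>- \<rho>'\<close> and the last is \<open>\<rho>\<close>.\<close>
  have eq: "(y - g)\<^sup>2 * ?f y = (z - y)\<^sup>2 * ?f y + 2 * ?a * ((z - y) * ?f y) + ?a\<^sup>2 * ?f y" for y
    by (simp add: power2_eq_square algebra_simps)
  have i: "integrable Q (\<lambda>y. (y - g)\<^sup>2 * ?f y)"
    unfolding eq using int by auto
  have "(\<integral>y. (y - g)\<^sup>2 * ?f y \<partial>Q) = (\<integral>y. (z - y)\<^sup>2 * ?f y \<partial>Q) - 2 * ?a * \<rho>' + ?a\<^sup>2 * \<rho>"
    unfolding eq using int by (simp add: \<rho>_def \<rho>'_def deriv_gauss_smooth gauss_smooth_def)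
  moreover have pos: "\<rho> > 0" unfolding \<rho>_def by (rule gauss_smooth_pos)
  then have "\<rho> * (g - (z + \<rho>' / \<rho>))\<^sup>2 = ?a\<^sup>2 * \<rho> - 2 * ?a * \<rho>' + \<rho>'\<^sup>2 / \<rho>"
    by (simp add: field_simps power2_eq_square)
  ultimately have "(\<integral>y. (y - g)\<^sup>2 * ?f y \<partial>Q) + \<rho>'\<^sup>2 / \<rho> =
      (\<integral>y. (z - y)\<^sup>2 * ?f y \<partial>Q) + \<rho> * (g - (z + \<rho>' / \<rho>))\<^sup>2"
    by simp
  with i int(3) pos show ?thesis
    by (simp add: nn_integral_eq_integral ennreal_plus[symmetric] del: ennreal_plus)
qed

end

section \<open>Mean square error and Fisher information\<close>

text \<open>The risk conditional on the controlled state being \<open>y\<close>. As a function of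
  \<open>y\<close> alone it can be integrated against the law of the state or against a
  coupling.\<close>

definition estimation_loss :: "(real \<Rightarrow> real) \<Rightarrow> real \<Rightarrow> ennreal" where
  "estimation_loss \<gamma> y = (\<integral>\<^sup>+n. ennreal ((y - \<gamma> (y + n))\<^sup>2) \<partial>std_normal_distribution)"

lemma borel_measurable_estimation_loss [measurable]:
  assumes [measurable]: "\<gamma> \<in> borel_measurable borel"
  shows "estimation_loss \<gamma> \<in> borel_measurable borel"
proof -
  interpret prob_space std_normal_distribution by (rule prob_space_normal_density) simp
  show ?thesis unfolding estimation_loss_def[abs_def] by measurable
qed

text \<open>The substitution \<open>z = y + n\<close> moves \<open>y\<close> out of the argument of
  \<gamma>, which is merely measurable, into a smooth kernel. This is what makes continuity in
  \<open>y\<close> possible.\<close>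

lemma estimation_loss_eq:
  assumes [measurable]: "\<gamma> \<in> borel_measurable borel"
  shows "estimation_loss \<gamma> y = (\<integral>\<^sup>+z. ennreal ((y - \<gamma> z)\<^sup>2 * std_normal_density (z - y)) \<partial>lborel)"
  unfolding estimation_loss_def
  by (subst nn_integral_density, simp, simp,
      subst (2) nn_integral_real_affine[where c = 1 and t = y])
     (auto simp: ennreal_mult' mult.commute)

lemma nn_integral_std_normal_second_moment:
  "(\<integral>\<^sup>+z. ennreal (z\<^sup>2 * std_normal_density z) \<partial>lborel) = 1"
  using std_normal_moment_even[of 1]
  by (subst nn_integral_eq_integral)
     (auto simp: has_bochner_integral_iff mult.commute)

text \<open>Integrate the pointwise decomposition over \<open>z\<close> and exchange integrals by
  Tonelli; after a shift by \<open>y\<close> the leftover second moment is the noise variance 1. The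
  last integral is the excess risk of \<gamma> over the posterior mean.\<close>

lemma estimation_loss_plus_fisher_information:
  assumes Q: "prob_space Q" and sets_Q[measurable_cong]: "sets Q = sets borel"
    and [measurable]: "\<gamma> \<in> borel_measurable borel"
  defines "\<rho> \<equiv> gauss_smooth Q"
  shows "(\<integral>\<^sup>+y. estimation_loss \<gamma> y \<partial>Q) + fisher_information \<rho> =
    1 + (\<integral>\<^sup>+z. ennreal (\<rho> z * (\<gamma> z - (z + deriv \<rho> z / \<rho> z))\<^sup>2) \<partial>lborel)"
proof -
  interpret prob_space Q by (fact Q)
  interpret pair_sigma_finite lborel Q by unfold_locales
  have [measurable]: "\<rho> \<in> borel_measurable borel" "deriv \<rho> \<in> borel_measurable borel"
    unfolding \<rho>_def using borel_measurable_gauss_smooth[OF Q sets_Q] by auto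
  have "(\<integral>\<^sup>+y. estimation_loss \<gamma> y \<partial>Q) + fisher_information \<rho> =
     (\<integral>\<^sup>+z. (\<integral>\<^sup>+y. ennreal ((y - \<gamma> z)\<^sup>2 * std_normal_density (z - y)) \<partial>Q) \<partial>lborel)
      + fisher_information \<rho>"
    by (subst Fubini'[symmetric], measurable,
        subst nn_integral_cong[OF estimation_loss_eq]) auto
  also have "\<dots> = (\<integral>\<^sup>+z. (\<integral>\<^sup>+y. ennreal ((y - \<gamma> z)\<^sup>2 * std_normal_density (z - y)) \<partial>Q) +
       ennreal ((deriv \<rho> z)\<^sup>2 / \<rho> z) \<partial>lborel)"
    unfolding fisher_information_def by (rule nn_integral_add[symmetric]) measurable
  also have "\<dots> = (\<integral>\<^sup>+z. (\<integral>\<^sup>+y. ennreal ((z - y)\<^sup>2 * std_normal_density (z - y)) \<partial>Q) +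
       ennreal (\<rho> z * (\<gamma> z - (z + deriv \<rho> z / \<rho> z))\<^sup>2) \<partial>lborel)"
    unfolding \<rho>_def by (subst posterior_risk_decomposition[OF Q sets_Q]) (rule refl)
  also have "\<dots> = (\<integral>\<^sup>+z. (\<integral>\<^sup>+y. ennreal ((z - y)\<^sup>2 * std_normal_density (z - y)) \<partial>Q) \<partial>lborel) +
       (\<integral>\<^sup>+z. ennreal (\<rho> z * (\<gamma> z - (z + deriv \<rho> z / \<rho> z))\<^sup>2) \<partial>lborel)"
    by (rule nn_integral_add) measurable
  also have "(\<integral>\<^sup>+z. (\<integral>\<^sup>+y. ennreal ((z - y)\<^sup>2 * std_normal_density (z - y)) \<partial>Q) \<partial>lborel) =
      (\<integral>\<^sup>+y. (\<integral>\<^sup>+z. ennreal ((z - y)\<^sup>2 * std_normal_density (z - y)) \<partial>lborel) \<partial>Q)"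
    by (subst Fubini') auto
  also have "\<dots> = (\<integral>\<^sup>+y. 1 \<partial>Q)"
  proof -
    have "(\<integral>\<^sup>+z. ennreal ((z - y)\<^sup>2 * std_normal_density (z - y)) \<partial>lborel) = 1" for y
      by (subst nn_integral_real_affine[where c = 1 and t = y])
         (auto simp: nn_integral_std_normal_second_moment)
    then show ?thesis by simp
  qed
  finally show ?thesis by (simp add: emeasure_space_1)
qed

lemma one_le_estimation_loss_plus_fisher_information:
  assumes "prob_space Q" "sets Q = sets borel" "\<gamma> \<in> borel_measurable borel"
  shows "1 \<le> (\<integral>\<^sup>+y. estimation_loss \<gamma> y \<partial>Q) + fisher_information (gauss_smooth Q)"
  using estimation_loss_plus_fisher_information[OF assms] by simp

text \<open>Tweedie's formula: \<open>z + \<rho>'(z) / \<rho>(z)\<close> is the posterior mean.\<close>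

lemma optimal_estimator:
  assumes Q: "prob_space Q" and sets_Q: "sets Q = sets borel"
  obtains \<gamma> where "\<gamma> \<in> borel_measurable borel"
    "(\<integral>\<^sup>+y. estimation_loss \<gamma> y \<partial>Q) + fisher_information (gauss_smooth Q) = 1"
proof
  let ?\<rho> = "gauss_smooth Q"
  note [measurable] = borel_measurable_gauss_smooth[OF Q sets_Q]
  show *: "(\<lambda>z. z + deriv ?\<rho> z / ?\<rho> z) \<in> borel_measurable borel" by measurable
  show "(\<integral>\<^sup>+y. estimation_loss (\<lambda>z. z + deriv ?\<rho> z / ?\<rho> z) y \<partial>Q) + fisher_information ?\<rho> = 1"
    using estimation_loss_plus_fisher_information[OF Q sets_Q *] by simp
qed


section \<open>Truncation of estimators and continuity of the loss\<close>

text \<open>Dominated convergence on the product of \<open>Q\<close> and the noise law, with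
  \<open>y^2\<close> plus the untruncated loss as dominating function; the second moment of
  \<open>Q\<close> makes it integrable. It allows passing to bounded estimators, whose loss is
  continuous.\<close>

lemma estimation_loss_truncation:
  assumes Q: "Q \<in> P2" and [measurable]: "\<gamma> \<in> borel_measurable borel"
    and fin: "(\<integral>\<^sup>+y. estimation_loss \<gamma> y \<partial>Q) < \<infinity>"
  shows "(\<lambda>i. \<integral>\<^sup>+y. estimation_loss (\<lambda>z. max (- real i) (min (real i) (\<gamma> z))) y \<partial>Q)
    \<longlonglongrightarrow> (\<integral>\<^sup>+y. estimation_loss \<gamma> y \<partial>Q)"
proof -
  have Q': "prob_space Q" and [measurable_cong]: "sets Q = sets borel"
    and mom: "(\<integral>\<^sup>+y. ennreal (y\<^sup>2) \<partial>Q) < \<infinity>"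
    using Q by (auto simp: P2_def)
  interpret Q: prob_space Q by fact
  interpret S: prob_space std_normal_distribution by (rule prob_space_normal_density) simp
  interpret pair_prob_space Q std_normal_distribution ..
  let ?g = "\<lambda>i z. max (- real i) (min (real i) (\<gamma> z))"
  let ?l = "\<lambda>f (y, n). ennreal ((y - f (y + n))\<^sup>2)"
  let ?m = "\<lambda>(y, n). ennreal (y\<^sup>2) :: ennreal"
  have loss: "(\<integral>\<^sup>+y. estimation_loss f y \<partial>Q) = (\<integral>\<^sup>+p. ?l f p \<partial>(Q \<Otimes>\<^sub>M std_normal_distribution))"
    if [measurable]: "f \<in> borel_measurable borel" for f
    unfolding estimation_loss_def by (subst S.nn_integral_fst[symmetric]) auto
  have "(\<integral>\<^sup>+p. ?m p \<partial>(Q \<Otimes>\<^sub>M std_normal_distribution)) = (\<integral>\<^sup>+y. ennreal (y\<^sup>2) \<partial>Q)"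
    by (subst S.nn_integral_fst[symmetric]) (auto simp: S.emeasure_space_1[simplified])
  then have w: "(\<integral>\<^sup>+p. ?m p + ?l \<gamma> p \<partial>(Q \<Otimes>\<^sub>M std_normal_distribution)) < \<infinity>"
    using mom fin by (subst nn_integral_add) (auto simp: loss)
  have bound: "(y - ?g i z)\<^sup>2 \<le> y\<^sup>2 + (y - \<gamma> z)\<^sup>2" for i y z
  proof -
    \<comment> \<open>The clamped value lies between 0 and \<open>\<gamma> z\<close>, and the
      distance from \<open>y\<close> to a point of a segment is largest at an endpoint.\<close>
    have "\<bar>y - ?g i z\<bar> \<le> \<bar>y\<bar> \<or> \<bar>y - ?g i z\<bar> \<le> \<bar>y - \<gamma> z\<bar>" by (auto simp: max_def min_def)
    then have "(y - ?g i z)\<^sup>2 \<le> y\<^sup>2 \<or> (y - ?g i z)\<^sup>2 \<le> (y - \<gamma> z)\<^sup>2"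
      by (simp add: abs_le_square_iff)
    then show ?thesis by (smt (verit) zero_le_power2)
  qed
  have lim: "(\<lambda>i. ?l (?g i) p) \<longlonglongrightarrow> ?l \<gamma> p" for p
  proof (cases p)
    case (Pair y n)
    obtain j where j: "\<bar>\<gamma> (y + n)\<bar> \<le> real j" using real_arch_simple by blast
    have "?g i (y + n) = \<gamma> (y + n)" if "j \<le> i" for i
      using j of_nat_mono[OF that, where 'a = real] by linarith
    then show ?thesis
      unfolding Pair by (intro tendsto_eventually) (auto simp: eventually_sequentially intro!: exI[of _ j])
  qed
  have "(\<lambda>i. \<integral>\<^sup>+p. ?l (?g i) p \<partial>(Q \<Otimes>\<^sub>M std_normal_distribution))
      \<longlonglongrightarrow> (\<integral>\<^sup>+p. ?l \<gamma> p \<partial>(Q \<Otimes>\<^sub>M std_normal_distribution))"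
    by (rule nn_integral_dominated_convergence[OF _ _ _ _ w])
       (use lim bound in \<open>auto simp: ennreal_plus[symmetric] simp del: ennreal_plus intro!: ennreal_leI\<close>)
  then show ?thesis by (subst (1 2) loss) auto
qed

text \<open>One Gaussian of variance 2 dominates all unit-variance Gaussians with center moved by at
  most 1. The exponents compare because \<open>(u + 2 * d)^2\<close> is nonnegative;
  \<open>d^2 <= 1\<close> costs \<open>exp (1 / 2)\<close>, and \<open>sqrt 2\<close> corrects the
  normalization.\<close>

lemma std_normal_density_shift_le:
  assumes "\<bar>d\<bar> \<le> 1"
  shows "std_normal_density (u + d) \<le> sqrt 2 * exp (1 / 2) * normal_density 0 (sqrt 2) u"
proof -
  have "0 \<le> (u + 2 * d)\<^sup>2" "d\<^sup>2 \<le> 1" using assms by (auto simp: abs_square_le_1)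
  moreover have "(u + 2 * d)\<^sup>2 = 2 * (u + d)\<^sup>2 - u\<^sup>2 + 2 * d\<^sup>2"
    by (simp add: power2_eq_square algebra_simps)
  ultimately have "- (u + d)\<^sup>2 / 2 \<le> 1 / 2 + (- u\<^sup>2 / 4)"
    by linarith
  then have "exp (- (u + d)\<^sup>2 / 2) \<le> exp (1 / 2) * exp (- u\<^sup>2 / 4)"
    unfolding exp_add[symmetric] by simp
  then have "1 / sqrt (2 * pi) * exp (- (u + d)\<^sup>2 / 2) \<le> 1 / sqrt (2 * pi) * (exp (1 / 2) * exp (- u\<^sup>2 / 4))"
    by (intro mult_left_mono) auto
  also have "\<dots> = sqrt 2 * exp (1 / 2) * normal_density 0 (sqrt 2) u"
    by (simp add: normal_density_def real_sqrt_mult field_simps)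
  finally show ?thesis by (simp add: std_normal_density_def)
qed

text \<open>Dominated convergence over the observation \<open>z\<close>. Discontinuities of \<gamma>
  are harmless because the moving state enters only through the square and the Gaussian
  kernel.\<close>

lemma estimation_loss_tendsto:
  assumes [measurable]: "\<gamma> \<in> borel_measurable borel" and B: "\<And>z. \<bar>\<gamma> z\<bar> \<le> B"
    and q: "q \<longlonglongrightarrow> y" "\<And>i. \<bar>q i - y\<bar> \<le> 1"
  shows "(\<lambda>i. estimation_loss \<gamma> (q i)) \<longlonglongrightarrow> estimation_loss \<gamma> y"
proof -
  \<comment> \<open>The first factor bounds \<open>(q i - \<gamma> z)^2\<close> when
    \<open>q i\<close> is within 1 of \<open>y\<close>; the second is the constant of the Gaussian
    shift bound.\<close>
  let ?C = "(\<bar>y\<bar> + 1 + B)\<^sup>2 * (sqrt 2 * exp (1 / 2))"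
  let ?w = "\<lambda>z. ennreal (?C * normal_density y (sqrt 2) z)"
  let ?f = "\<lambda>y z. ennreal ((y - \<gamma> z)\<^sup>2 * std_normal_density (z - y))"
  have C: "0 \<le> ?C" by simp
  have "(\<integral>\<^sup>+z. ?w z \<partial>lborel) = ennreal ?C * (\<integral>\<^sup>+z. ennreal (normal_density y (sqrt 2) z) \<partial>lborel)"
    unfolding ennreal_mult'[OF C] by (rule nn_integral_cmult) simp
  also have "\<dots> < \<infinity>"
    by (subst nn_integral_eq_integral) (auto simp: ennreal_mult_less_top)
  finally have w: "(\<integral>\<^sup>+z. ?w z \<partial>lborel) < \<infinity>" .
  have bound: "(q i - \<gamma> z)\<^sup>2 * std_normal_density (z - q i) \<le> ?C * normal_density y (sqrt 2) z" for i z
  proof -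
    have "\<bar>q i - \<gamma> z\<bar> \<le> \<bar>y\<bar> + 1 + B" using q(2)[of i] B[of z] by linarith
    then have "(q i - \<gamma> z)\<^sup>2 \<le> (\<bar>y\<bar> + 1 + B)\<^sup>2"
      by (metis abs_ge_zero power2_abs power_mono)
    moreover have "std_normal_density (z - q i) \<le> sqrt 2 * exp (1 / 2) * normal_density y (sqrt 2) z"
      using std_normal_density_shift_le[of "y - q i" "z - y"] q(2)[of i]
      by (simp add: normal_density_def abs_minus_commute)
    ultimately have "(q i - \<gamma> z)\<^sup>2 * std_normal_density (z - q i)
        \<le> (\<bar>y\<bar> + 1 + B)\<^sup>2 * (sqrt 2 * exp (1 / 2) * normal_density y (sqrt 2) z)"
      by (intro mult_mono) auto
    then show ?thesis by (simp only: mult.assoc)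
  qed
  have lim: "(\<lambda>i. ?f (q i) z) \<longlonglongrightarrow> ?f y z" for z
    unfolding std_normal_density_def by (intro tendsto_ennrealI tendsto_intros q) auto
  have "(\<lambda>i. \<integral>\<^sup>+z. ?f (q i) z \<partial>lborel) \<longlonglongrightarrow> (\<integral>\<^sup>+z. ?f y z \<partial>lborel)"
    by (rule nn_integral_dominated_convergence[OF _ _ _ _ w])
       (use lim bound in \<open>auto intro!: ennreal_leI\<close>)
  then show ?thesis by (simp add: estimation_loss_eq)
qed

section \<open>Measurable selection and derandomization of couplings\<close>

text \<open>Over a countable index set the least admissible index is a measurable choice. One exists
  because \<epsilon> is positive, and trivially when the infimum is infinite.\<close>

lemma measurable_approximate_minimizer:
  fixes f :: "nat \<Rightarrow> 'a \<Rightarrow> ennreal" and \<epsilon> :: ennreal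
  assumes [measurable]: "\<And>i. f i \<in> borel_measurable M" and "0 < \<epsilon>"
  obtains s where "s \<in> measurable M (count_space UNIV)" "\<And>x. f (s x) x \<le> (INF i. f i x) + \<epsilon>"
proof
  let ?s = "\<lambda>x. LEAST i. f i x \<le> (INF i. f i x) + \<epsilon>"
  show "?s \<in> measurable M (count_space UNIV)" by measurable
  fix x
  have "\<exists>i. f i x \<le> (INF i. f i x) + \<epsilon>"
  proof (cases "(INF i. f i x) = \<top>")
    case False
    then have "(INF i. f i x) < (INF i. f i x) + \<epsilon>"
      using \<open>0 < \<epsilon>\<close> by (cases "INF i. f i x"; cases \<epsilon>) (auto simp: ennreal_plus[symmetric] ennreal_less_iff simp del: ennreal_plus)
    then show ?thesis by (auto simp: INF_less_iff intro: less_imp_le)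
  qed simp
  then show "f (?s x) x \<le> (INF i. f i x) + \<epsilon>" by (rule LeastI_ex)
qed

lemma rational_sequence_right:
  obtains q :: "nat \<Rightarrow> real" where "range q \<subseteq> \<rat>" "q \<longlonglongrightarrow> y" "\<And>i. \<bar>q i - y\<bar> \<le> 1"
proof -
  have "\<exists>r\<in>\<rat>. y < r \<and> r < y + inverse (real (Suc i))" for i
    by (rule Rats_dense_in_real) simp
  then obtain q where q: "\<And>i. q i \<in> \<rat>" "\<And>i. y < q i" "\<And>i. q i < y + inverse (real (Suc i))"
    by metis
  show ?thesis
  proof
    show "range q \<subseteq> \<rat>" using q by auto
    show "q \<longlonglongrightarrow> y"
    proof (rule tendsto_sandwich[where f = "\<lambda>_. y" and h = "\<lambda>i. y + inverse (real (Suc i))"])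
      show "(\<lambda>i. y + inverse (real (Suc i))) \<longlonglongrightarrow> y"
        using tendsto_add[OF tendsto_const LIMSEQ_inverse_real_of_nat, of y] by simp
    qed (use q in \<open>auto intro!: always_eventually less_imp_le simp del: of_nat_Suc\<close>)
    show "\<bar>q i - y\<bar> \<le> 1" for i
    proof -
      have "inverse (real (Suc i)) \<le> 1" by (simp add: inverse_le_1_iff)
      then show ?thesis using q(2,3)[of i] by linarith
    qed
  qed
qed

text \<open>A coupling may split the mass at \<open>x\<close> among many targets, whereas a
  controller may not. A near-minimizing target \<open>s x\<close> costs at most \<epsilon> more than
  every \<open>y\<close>, so integrating over the coupling gives the bound. The image of
  \<open>P\<close> under \<open>s\<close> need not be \<open>Q\<close>; only costs are
  compared.\<close>

lemma deterministic_strategy: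
  assumes \<pi>: "\<pi> \<in> couplings P Q" and \<gamma>[measurable]: "\<gamma> \<in> borel_measurable borel"
    and B: "\<And>z. \<bar>\<gamma> z\<bar> \<le> B" and "0 < \<epsilon>"
  obtains s where "s \<in> borel_measurable borel"
    "(\<integral>\<^sup>+x. ennreal (k\<^sup>2) * ennreal ((x - s x)\<^sup>2) + estimation_loss \<gamma> (s x) \<partial>P) \<le>
     ennreal (k\<^sup>2) * (\<integral>\<^sup>+(x, y). ennreal ((x - y)\<^sup>2) \<partial>\<pi>) + (\<integral>\<^sup>+y. estimation_loss \<gamma> y \<partial>Q) + \<epsilon>"
proof -
  interpret \<pi>: prob_space \<pi> using \<pi> by (simp add: couplings_def)
  have [measurable_cong]: "sets \<pi> = sets (borel \<Otimes>\<^sub>M borel)"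
    and P: "P = distr \<pi> borel fst" and Q: "Q = distr \<pi> borel snd"
    using \<pi> by (auto simp: couplings_def)
  define c where "c x y = ennreal (k\<^sup>2) * ennreal ((x - y)\<^sup>2) + estimation_loss \<gamma> y" for x y
  \<comment> \<open>Enumerating the rationals makes the minimization countable, hence the infimum
    \<open>m\<close> and its near-minimizer measurable.\<close>
  define r where "r = from_nat_into (\<rat> :: real set)"
  have [measurable]: "case_prod c \<in> borel_measurable (borel \<Otimes>\<^sub>M borel)"
    unfolding c_def[abs_def] by measurable
  have r: "range r = \<rat>"
    unfolding r_def by (rule range_from_nat_into) (auto simp: countable_rat)
  define m where "m x = (INF i. c x (r i))" for x
  have m[measurable]: "m \<in> borel_measurable borel"
    unfolding m_def[abs_def] by measurable
  obtain i where i: "i \<in> measurable borel (count_space UNIV)" "\<And>x. c x (r (i x)) \<le> m x + \<epsilon>"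
    using measurable_approximate_minimizer[of "\<lambda>i x. c x (r i)" borel \<epsilon>] \<open>0 < \<epsilon>\<close>
    unfolding m_def by auto
  \<comment> \<open>The infimum over rational targets bounds the cost at every real target:
    \<open>c x\<close> is continuous along rationals tending to \<open>y\<close>.\<close>
  have m_le: "m x \<le> c x y" for x y
  proof -
    obtain q where q: "range q \<subseteq> \<rat>" "q \<longlonglongrightarrow> y" "\<And>i. \<bar>q i - y\<bar> \<le> 1"
      using rational_sequence_right[of y] by blast
    have "(\<lambda>i. ennreal (k\<^sup>2 * (x - q i)\<^sup>2)) \<longlonglongrightarrow> ennreal (k\<^sup>2 * (x - y)\<^sup>2)"
      by (intro tendsto_ennrealI tendsto_intros q)
    then have "(\<lambda>i. c x (q i)) \<longlonglongrightarrow> c x y"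
      unfolding c_def using estimation_loss_tendsto[OF \<gamma> B q(2,3)]
      by (intro tendsto_add) (simp_all add: ennreal_mult')
    moreover have "m x \<le> c x (q i)" for i
    proof -
      obtain j where "q i = r j" using q(1) r by (metis imageE rangeI subsetD)
      then show ?thesis by (auto simp: m_def intro: INF_lower)
    qed
    ultimately show ?thesis by (intro LIMSEQ_le_const[of "\<lambda>i. c x (q i)"]) auto
  qed
  have s[measurable]: "(\<lambda>x. r (i x)) \<in> borel_measurable borel"
    using measurable_compose[OF i(1), of r] by simp
  have "(\<integral>\<^sup>+x. c x (r (i x)) \<partial>P) \<le> (\<integral>\<^sup>+x. m x + \<epsilon> \<partial>P)"
    by (intro nn_integral_mono i)
  also have "\<dots> = (\<integral>\<^sup>+p. m (fst p) + \<epsilon> \<partial>\<pi>)"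
    unfolding P by (subst nn_integral_distr) auto
  also have "\<dots> \<le> (\<integral>\<^sup>+p. c (fst p) (snd p) + \<epsilon> \<partial>\<pi>)"
    by (intro nn_integral_mono add_right_mono m_le)
  also have "\<dots> = (\<integral>\<^sup>+p. ennreal (k\<^sup>2) * ennreal ((fst p - snd p)\<^sup>2) \<partial>\<pi>) + (\<integral>\<^sup>+p. estimation_loss \<gamma> (snd p) \<partial>\<pi>) + \<epsilon>"
    unfolding c_def by (simp add: nn_integral_add \<pi>.emeasure_space_1)
  also have "(\<integral>\<^sup>+p. ennreal (k\<^sup>2) * ennreal ((fst p - snd p)\<^sup>2) \<partial>\<pi>) =
      ennreal (k\<^sup>2) * (\<integral>\<^sup>+(x, y). ennreal ((x - y)\<^sup>2) \<partial>\<pi>)"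
    by (subst nn_integral_cmult) (auto simp: case_prod_unfold)
  also have "(\<integral>\<^sup>+p. estimation_loss \<gamma> (snd p) \<partial>\<pi>) = (\<integral>\<^sup>+y. estimation_loss \<gamma> y \<partial>Q)"
    unfolding Q by (subst nn_integral_distr) auto
  finally show ?thesis using that[OF s] by (simp add: c_def)
qed


section \<open>Reduction of the control problem to laws of the controlled state\<close>

text \<open>By independence the joint law of \<open>X0\<close> and \<open>N\<close> is a product, so
  the noise can be integrated out first at a fixed initial state.\<close>

lemma witsenhausen_cost_eq:
  assumes "prob_space M" and P: "distr M borel X0 = P"
    and N: "distr M borel N = std_normal_distribution"
    and ind: "prob_space.indep_var M borel X0 borel N"
    and [measurable]: "\<gamma>1 \<in> borel_measurable borel" "\<gamma>2 \<in> borel_measurable borel"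
  shows "witsenhausen_cost k M X0 N \<gamma>1 \<gamma>2 =
    ennreal (k\<^sup>2) * (\<integral>\<^sup>+x. ennreal ((\<gamma>1 x)\<^sup>2) \<partial>P) + (\<integral>\<^sup>+x. estimation_loss \<gamma>2 (x + \<gamma>1 x) \<partial>P)"
proof -
  interpret prob_space M by fact
  have rv[measurable]: "random_variable borel X0" "random_variable borel N"
    and joint: "P \<Otimes>\<^sub>M std_normal_distribution = distr M (borel \<Otimes>\<^sub>M borel) (\<lambda>x. (X0 x, N x))"
    using ind unfolding indep_var_distribution_eq P N by auto
  interpret S: prob_space std_normal_distribution by (rule prob_space_normal_density) simp
  let ?e = "\<lambda>x n. ennreal ((x + \<gamma>1 x - \<gamma>2 (x + \<gamma>1 x + n))\<^sup>2)"
  have [measurable_cong]: "sets P = sets borel" using P by auto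
  have "(\<integral>\<^sup>+\<omega>. ?e (X0 \<omega>) (N \<omega>) \<partial>M) =
      (\<integral>\<^sup>+p. case_prod ?e p \<partial>distr M (borel \<Otimes>\<^sub>M borel) (\<lambda>x. (X0 x, N x)))"
    by (subst nn_integral_distr) auto
  also have "\<dots> = (\<integral>\<^sup>+x. estimation_loss \<gamma>2 (x + \<gamma>1 x) \<partial>P)"
    unfolding joint[symmetric] estimation_loss_def
    by (subst S.nn_integral_fst[symmetric]) auto
  finally have "(\<integral>\<^sup>+\<omega>. ?e (X0 \<omega>) (N \<omega>) \<partial>M) = (\<integral>\<^sup>+x. estimation_loss \<gamma>2 (x + \<gamma>1 x) \<partial>P)" .
  moreover have "(\<integral>\<^sup>+\<omega>. ennreal ((\<gamma>1 (X0 \<omega>))\<^sup>2) \<partial>M) = (\<integral>\<^sup>+x. ennreal ((\<gamma>1 x)\<^sup>2) \<partial>P)"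
    unfolding P[symmetric] by (subst nn_integral_distr) auto
  ultimately show ?thesis by (simp add: witsenhausen_cost_def)
qed

text \<open>The joint law of \<open>x\<close> and \<open>x + u x\<close> is a coupling whose
  transport cost is exactly the control energy. The second moment is finite by
  \<open>(a + b)^2 <= 2 * a^2 + 2 * b^2\<close>.\<close>

lemma push_forward_strategy:
  assumes P: "P \<in> P2" and [measurable]: "u \<in> borel_measurable borel"
    and fin: "(\<integral>\<^sup>+x. ennreal ((u x)\<^sup>2) \<partial>P) < \<infinity>"
  defines "Q \<equiv> distr P borel (\<lambda>x. x + u x)"
  shows "Q \<in> P2" "W2_squared P Q \<le> (\<integral>\<^sup>+x. ennreal ((u x)\<^sup>2) \<partial>P)"
proof -
  have sets_P[measurable_cong]: "sets P = sets borel"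
    and mom: "(\<integral>\<^sup>+x. ennreal (x\<^sup>2) \<partial>P) < \<infinity>" and "prob_space P"
    using P by (auto simp: P2_def)
  interpret prob_space P by fact
  have sq: "(x + u x)\<^sup>2 \<le> 2 * x\<^sup>2 + 2 * (u x)\<^sup>2" for x
    using zero_le_power2[of "x - u x"] by (simp add: power2_eq_square algebra_simps)
  have "(\<integral>\<^sup>+x. ennreal ((x + u x)\<^sup>2) \<partial>P) \<le> (\<integral>\<^sup>+x. 2 * ennreal (x\<^sup>2) + 2 * ennreal ((u x)\<^sup>2) \<partial>P)"
  proof (rule nn_integral_mono)
    fix x
    show "ennreal ((x + u x)\<^sup>2) \<le> 2 * ennreal (x\<^sup>2) + 2 * ennreal ((u x)\<^sup>2)"
      using ennreal_leI[OF sq[of x]] by (simp add: ennreal_mult)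
  qed
  also have "\<dots> < \<infinity>"
    using mom fin by (simp add: nn_integral_add nn_integral_cmult ennreal_mult_less_top)
  finally have "(\<integral>\<^sup>+x. ennreal (x\<^sup>2) \<partial>Q) < \<infinity>"
    unfolding Q_def by (subst nn_integral_distr) auto
  then show "Q \<in> P2"
    unfolding P2_def Q_def using prob_space_distr[of "\<lambda>x. x + u x" borel] by simp
  let ?\<pi> = "distr P (borel \<Otimes>\<^sub>M borel) (\<lambda>x. (x, x + u x))"
  have "?\<pi> \<in> couplings P Q"
    unfolding couplings_def Q_def
    by (auto simp: distr_distr o_def sets_P distr_id2 intro!: prob_space_distr)
  then have "W2_squared P Q \<le> (\<integral>\<^sup>+(x, y). ennreal ((x - y)\<^sup>2) \<partial>?\<pi>)"
    unfolding W2_squared_def by (rule INF_lower)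
  also have "\<dots> = (\<integral>\<^sup>+x. ennreal ((u x)\<^sup>2) \<partial>P)"
    by (subst nn_integral_distr) auto
  finally show "W2_squared P Q \<le> (\<integral>\<^sup>+x. ennreal ((u x)\<^sup>2) \<partial>P)" .
qed

text \<open>The optimal loss is the nonnegative remainder to 1. Hence
  \<open>1 - fisher_information (gauss_smooth Q)\<close> in \<open>ennreal\<close> is a genuine
  difference, not a truncated one.\<close>

lemma fisher_information_gauss_smooth_le_1:
  assumes "prob_space Q" "sets Q = sets borel"
  shows "fisher_information (gauss_smooth Q) \<le> 1"
  using optimal_estimator[OF assms] by (metis add.commute le_iff_add)

text \<open>The posterior mean may be unbounded; clamping it at a high enough level loses at most
  \<epsilon>.\<close>

lemma near_optimal_bounded_estimator:
  assumes Q: "Q \<in> P2" and "0 < \<epsilon>"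
  obtains \<gamma> B where "\<gamma> \<in> borel_measurable borel" "\<And>z. \<bar>\<gamma> z\<bar> \<le> B"
    "(\<integral>\<^sup>+y. estimation_loss \<gamma> y \<partial>Q) \<le> 1 - fisher_information (gauss_smooth Q) + \<epsilon>"
proof -
  let ?I = "fisher_information (gauss_smooth Q)"
  have Q': "prob_space Q" "sets Q = sets borel" using Q by (auto simp: P2_def)
  obtain \<gamma> where \<gamma>[measurable]: "\<gamma> \<in> borel_measurable borel"
    and opt: "(\<integral>\<^sup>+y. estimation_loss \<gamma> y \<partial>Q) + ?I = 1"
    using optimal_estimator[OF Q'] by blast
  let ?D = "\<integral>\<^sup>+y. estimation_loss \<gamma> y \<partial>Q"
  have I: "?I \<noteq> \<top>" using fisher_information_gauss_smooth_le_1[OF Q'] by (auto simp: top_unique)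
  have D: "?D = 1 - ?I" using opt I by (metis ennreal_add_diff_cancel_right)
  then have "?D < \<infinity>" by (simp add: less_top[symmetric])
  then have lt: "?D < ?D + \<epsilon>"
    using \<open>0 < \<epsilon>\<close> by (cases ?D; cases \<epsilon>) (auto simp: ennreal_plus[symmetric] ennreal_less_iff simp del: ennreal_plus)
  let ?g = "\<lambda>i z. max (- real i) (min (real i) (\<gamma> z))"
  obtain i where "(\<integral>\<^sup>+y. estimation_loss (?g i) y \<partial>Q) < ?D + \<epsilon>"
    using order_tendstoD(2)[OF estimation_loss_truncation[OF Q \<gamma> \<open>?D < \<infinity>\<close>] lt]
    by (auto simp: eventually_sequentially)
  then show ?thesis
    using that[of "?g i" "real i"] unfolding D by (auto intro: less_imp_le)
qed

text \<open>The duality in \<open>ennreal\<close>, as an infimum of sums: the transport cost, which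
  may be infinite, is never subtracted.\<close>

lemma witsenhausen_value_eq_INF:
  assumes P: "P \<in> P2" and M: "prob_space M" "distr M borel X0 = P"
    "distr M borel N = std_normal_distribution" "prob_space.indep_var M borel X0 borel N"
  assumes "k > 0"
  shows "witsenhausen_value k M X0 N =
    (INF Q\<in>P2. 1 - fisher_information (gauss_smooth Q) + ennreal (k\<^sup>2) * W2_squared P Q)"
    (is "?J = (INF Q\<in>P2. 1 - ?I Q + ?k * ?W Q)")
proof (rule antisym)
  have [measurable_cong]: "sets P = sets borel" using P by (simp add: P2_def)
  note cost = witsenhausen_cost_eq[OF M]
  show "?J \<le> (INF Q\<in>P2. 1 - ?I Q + ?k * ?W Q)"
  proof (rule INF_greatest)
    fix Q assume Q: "Q \<in> P2"
    \<comment> \<open>One \<epsilon> pays for the bounded estimator, the other for the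
      near-minimizing target.\<close>
    have coupling: "?J \<le> 1 - ?I Q + ?k * (\<integral>\<^sup>+(x, y). ennreal ((x - y)\<^sup>2) \<partial>\<pi>) + 2 * \<epsilon>"
      if \<pi>: "\<pi> \<in> couplings P Q" and "0 < \<epsilon>" for \<pi> and \<epsilon> :: ennreal
    proof -
      obtain \<gamma> B where \<gamma>[measurable]: "\<gamma> \<in> borel_measurable borel" and B: "\<And>z. \<bar>\<gamma> z\<bar> \<le> B"
        and D: "(\<integral>\<^sup>+y. estimation_loss \<gamma> y \<partial>Q) \<le> 1 - ?I Q + \<epsilon>"
        using near_optimal_bounded_estimator[OF Q \<open>0 < \<epsilon>\<close>] by blast
      obtain s where s[measurable]: "s \<in> borel_measurable borel" and le:
        "(\<integral>\<^sup>+x. ?k * ennreal ((x - s x)\<^sup>2) + estimation_loss \<gamma> (s x) \<partial>P) \<le>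
          ?k * (\<integral>\<^sup>+(x, y). ennreal ((x - y)\<^sup>2) \<partial>\<pi>) + (\<integral>\<^sup>+y. estimation_loss \<gamma> y \<partial>Q) + \<epsilon>"
        using deterministic_strategy[OF \<pi> \<gamma> B \<open>0 < \<epsilon>\<close>] by blast
      \<comment> \<open>The control \<open>s x - x\<close> steers the initial state \<open>x\<close>
        to the target \<open>s x\<close>.\<close>
      have "?J \<le> witsenhausen_cost k M X0 N (\<lambda>x. s x - x) \<gamma>"
        unfolding witsenhausen_value_def by (rule INF_lower2[of "(\<lambda>x. s x - x, \<gamma>)"]) auto
      also have "\<dots> = (\<integral>\<^sup>+x. ?k * ennreal ((x - s x)\<^sup>2) + estimation_loss \<gamma> (s x) \<partial>P)"
        by (subst cost) (auto simp: nn_integral_add nn_integral_cmult power2_commute)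
      also note le
      also have "?k * (\<integral>\<^sup>+(x, y). ennreal ((x - y)\<^sup>2) \<partial>\<pi>) + (\<integral>\<^sup>+y. estimation_loss \<gamma> y \<partial>Q) + \<epsilon> \<le>
          ?k * (\<integral>\<^sup>+(x, y). ennreal ((x - y)\<^sup>2) \<partial>\<pi>) + (1 - ?I Q + \<epsilon>) + \<epsilon>"
        using D by (intro add_mono order_refl)
      finally show ?thesis by (simp add: add_ac mult_2)
    qed
    show "?J \<le> 1 - ?I Q + ?k * ?W Q"
    proof (cases "?W Q = \<top>")
      case True
      then show ?thesis using \<open>k > 0\<close> by (simp add: ennreal_mult_top)
    next
      case False
      show ?thesis
      proof (rule ennreal_le_epsilon)
        fix e :: real assume "0 < e"
        \<comment> \<open>A coupling within \<open>d\<close> of the infimum contributes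
          \<open>k^2 * d\<close> and the previous bound \<open>2 * d\<close>; these errors add up to
          \<open>e\<close>.\<close>
        define d where "d = e / (k\<^sup>2 + 2)"
        have "0 < k\<^sup>2 + 2" by (simp add: add_nonneg_pos)
        then have d: "0 < d" "k\<^sup>2 * d + 2 * d = e"
          using \<open>0 < e\<close> by (simp_all add: d_def flip: distrib_right add_divide_distrib)
        have "?W Q < ?W Q + ennreal d"
          using False d by (cases "?W Q") (auto simp: ennreal_plus[symmetric] ennreal_less_iff simp del: ennreal_plus)
        then obtain \<pi> where \<pi>: "\<pi> \<in> couplings P Q"
          and le: "(\<integral>\<^sup>+(x, y). ennreal ((x - y)\<^sup>2) \<partial>\<pi>) < ?W Q + ennreal d"
          unfolding W2_squared_def by (auto simp: INF_less_iff)
        have "?J \<le> 1 - ?I Q + ?k * (\<integral>\<^sup>+(x, y). ennreal ((x - y)\<^sup>2) \<partial>\<pi>) + 2 * ennreal d"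
          using coupling[OF \<pi>] d by simp
        also have "\<dots> \<le> 1 - ?I Q + ?k * (?W Q + ennreal d) + 2 * ennreal d"
          using le by (intro add_mono mult_left_mono order_refl) auto
        also have "\<dots> = 1 - ?I Q + ?k * ?W Q + ennreal (k\<^sup>2 * d + 2 * d)"
          using d(1) by (simp add: distrib_left ennreal_mult ac_simps)
        finally show "?J \<le> 1 - ?I Q + ?k * ?W Q + ennreal e" unfolding d(2) .
      qed
    qed
  qed
next
  have [measurable_cong]: "sets P = sets borel" using P by (simp add: P2_def)
  show "(INF Q\<in>P2. 1 - ?I Q + ?k * ?W Q) \<le> ?J"
    unfolding witsenhausen_value_def
  proof (safe intro!: INF_greatest)
    fix u \<gamma> :: "real \<Rightarrow> real"
    assume [measurable]: "u \<in> borel_measurable borel" and \<gamma>[measurable]: "\<gamma> \<in> borel_measurable borel"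
    let ?U = "\<integral>\<^sup>+x. ennreal ((u x)\<^sup>2) \<partial>P"
    let ?Q = "distr P borel (\<lambda>x. x + u x)"
    have cost: "witsenhausen_cost k M X0 N u \<gamma> = ?k * ?U + (\<integral>\<^sup>+y. estimation_loss \<gamma> y \<partial>?Q)"
      by (subst witsenhausen_cost_eq[OF M]) (auto simp: nn_integral_distr)
    show "(INF Q\<in>P2. 1 - ?I Q + ?k * ?W Q) \<le> witsenhausen_cost k M X0 N u \<gamma>"
    \<comment> \<open>Infinite control energy makes the cost infinite, since \<open>k > 0\<close>;
      otherwise the law of the controlled state is a competitor in \<open>P2\<close>.\<close>
    proof (cases "?U = \<top>")
      case True
      then show ?thesis using \<open>k > 0\<close> by (simp add: cost ennreal_mult_top)
    next
      case False
      then have Q: "?Q \<in> P2" "?W ?Q \<le> ?U"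
        using push_forward_strategy[OF P, of u] by (auto simp: less_top)
      have "1 - ?I ?Q \<le> (\<integral>\<^sup>+y. estimation_loss \<gamma> y \<partial>?Q)"
        using one_le_estimation_loss_plus_fisher_information[OF _ _ \<gamma>, of ?Q] Q(1)
        by (auto simp: P2_def add.commute intro!: ennreal_minus_le_iff[THEN iffD2])
      then have "1 - ?I ?Q + ?k * ?W ?Q \<le> witsenhausen_cost k M X0 N u \<gamma>"
        unfolding cost using Q(2) by (subst add.commute) (intro add_mono mult_left_mono, auto)
      then show ?thesis by (rule INF_lower2[OF Q(1)])
    qed
  qed
qed

section \<open>Gaussian initial law and passage to extended reals\<close>

lemma normal_distribution_in_P2:
  assumes "\<sigma> > 0"
  shows "density lborel (\<lambda>x. ennreal (normal_density 0 \<sigma> x)) \<in> P2"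
  using normal_moment_even[OF assms, of 0 1] prob_space_normal_density[OF assms, of 0]
  by (simp add: P2_def nn_integral_density ennreal_mult'[symmetric] has_bochner_integral_iff
      nn_integral_eq_integral)

theorem corollary3p8:
  fixes \<sigma> k :: real and P :: "real measure"
    and M :: "'a measure" and X0 N :: "'a \<Rightarrow> real"
  assumes "\<sigma> > 0" and "k > 0"
    and "P = density lborel (\<lambda>x. ennreal (normal_density 0 \<sigma> x))"
    and "prob_space M"
    and "distr M borel X0 = P"
    and "distr M borel N = density lborel (\<lambda>x. ennreal (std_normal_density x))"
    and "prob_space.indep_var M borel X0 borel N"
  shows "enn2ereal (witsenhausen_value k M X0 N) =
    1 - (SUP Q\<in>P2. enn2ereal (fisher_information (gauss_smooth Q))
                     - ereal (k\<^sup>2) * enn2ereal (W2_squared P Q))"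
proof -
  let ?I = "\<lambda>Q. fisher_information (gauss_smooth Q)"
  have P: "P \<in> P2" using assms(1,3) normal_distribution_in_P2 by simp
  have term_eq: "enn2ereal (1 - ?I Q + ennreal (k\<^sup>2) * W2_squared P Q) =
      1 - (enn2ereal (?I Q) - ereal (k\<^sup>2) * enn2ereal (W2_squared P Q))" if "Q \<in> P2" for Q
  proof -
    have "?I Q \<le> 1" using that by (intro fisher_information_gauss_smooth_le_1) (auto simp: P2_def)
    then obtain i where i: "0 \<le> i" "i \<le> 1" "?I Q = ennreal i"
      by (cases "?I Q") (auto simp: top_unique)
    have I: "1 - ?I Q = ennreal (1 - i)"
      using i by (simp add: ennreal_minus ennreal_1[symmetric] del: ennreal_1)
    show ?thesis
    \<comment> \<open>The Fisher information is finite, so no indeterminate difference arises: an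
      infinite transport cost gives minus infinity inside the supremum and infinity on the
      left.\<close>
    proof (cases "W2_squared P Q")
      case (real w)
      then have "1 - ?I Q + ennreal (k\<^sup>2) * W2_squared P Q = ennreal (1 - i + k\<^sup>2 * w)"
        unfolding I using i by (simp add: ennreal_mult)
      moreover have "0 \<le> 1 - i + k\<^sup>2 * w" using i real by simp
      ultimately show ?thesis
        using i real by (simp add: enn2ereal_ennreal one_ereal_def del: ennreal_plus)
    next
      case top
      then show ?thesis using \<open>k > 0\<close> i by (simp add: I ennreal_mult_top enn2ereal_ennreal one_ereal_def)
    qed
  qed
  have "enn2ereal (witsenhausen_value k M X0 N) =
      (INF Q\<in>P2. enn2ereal (1 - ?I Q + ennreal (k\<^sup>2) * W2_squared P Q))"
    using assms by (subst witsenhausen_value_eq_INF[OF P]) (auto simp: Inf_ennreal.rep_eq image_image)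
  also have "\<dots> = (INF Q\<in>P2. 1 - (enn2ereal (?I Q) - ereal (k\<^sup>2) * enn2ereal (W2_squared P Q)))"
    by (intro INF_cong refl term_eq)
  \<comment> \<open>Reflection at the finite constant 1 turns the infimum into a supremum over a
    nonempty set; \<open>P\<close> itself witnesses nonemptiness of \<open>P2\<close>.\<close>
  also have "\<dots> = 1 - (SUP Q\<in>P2. enn2ereal (?I Q) - ereal (k\<^sup>2) * enn2ereal (W2_squared P Q))"
    using P by (intro INF_ereal_minus_right) auto
  finally show ?thesis .
qed

end
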